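(* Let $A\in\mathbb R^{(m+pm)\times(m+pm)}$ be a symmetric positive definite $CB^3(\ell,\ell;1,0)$ or $CB^3(\ell,\ell;0,1)$ matrix. Then the reverse Cholesky factor $L$ of $A$ can be decomposed as $L=L_1+L_2$, where $L_1$ is a $CB^3(\ell,0;1,1)$ matrix and $$L_2=\begin{bmatrix}\widetilde L_2&\mathbf 0\\ \mathbf 0&\mathbf 0\end{bmatrix},$$ with $\widetilde L_2\in\mathbb R^{m\times m}$ a matrix whose only non-zero entries are in the first column.
   Context: Reverse Cholesky factor of a symmetric positive definite $A$: the lower triangular matrix $L$ (with positive diagonal) such that $A=L^{\mathsf T}L$. Cyclic banded matrix: $A\in\mathbb R^{m\times m}$ is cyclic banded with sub-bandwidths $(\ell,u)$ if $a_{ij}=0$ whenever $i-j>\ell$ or $j-i>u$, except possibly when $m-i+j\le u$ or $m+i-j\le\ell$. $CB^3$-arrowhead matrix: $A\in\mathbb R^{(m+pm)\times(m+pm)}$, partitioned into $(p+1)\times(p+1)$ blocks of size $m\times m$, is a $CB^3(\ell,u;\lambda,\mu)$ matrix if (1) it is block-banded with block-bandwidths $(\ell,u)$ (block $(I,J)$ vanishes unless $-\ell\le J-I\le u$); (2) the top-left block is cyclic banded with sub-bandwidths $(\lambda+\mu,\lambda+\mu)$; (3) the remaining blocks in the first block row are cyclic banded with sub-bandwidths $(\lambda,\mu)$; (4) the remaining blocks in the first block column are cyclic banded with sub-bandwidths $(\mu,\lambda)$; (5) all other blocks are diagonal. *)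

theory Defs
  imports "Jordan_Normal_Form.Matrix"
begin

definition symmetric_mat :: "'a mat \<Rightarrow> bool" where
  "symmetric_mat A \<longleftrightarrow> A\<^sup>T = A"

definition pos_def_mat :: "real mat \<Rightarrow> bool" where
  "pos_def_mat A \<longleftrightarrow> square_mat A \<and>
     (\<forall>v \<in> carrier_vec (dim_row A). v \<noteq> 0\<^sub>v (dim_row A) \<longrightarrow> v \<bullet> (A *\<^sub>v v) > 0)"

definition lower_triangular :: "'a::zero mat \<Rightarrow> bool" where
  "lower_triangular A \<longleftrightarrow> (\<forall>i < dim_row A. \<forall>j < dim_col A. i < j \<longrightarrow> A $$ (i,j) = 0)"

(* For symmetric positive definite A there is exactly one such L. *)
definition reverse_cholesky_factor :: "real mat \<Rightarrow> real mat \<Rightarrow> bool" where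
  "reverse_cholesky_factor A L \<longleftrightarrow>
     L \<in> carrier_mat (dim_row A) (dim_row A) \<and> lower_triangular L \<and>
     (\<forall>i < dim_row A. L $$ (i,i) > 0) \<and> A = L\<^sup>T * L"

(* The inequalities i - j > l, j - i > u, m - i + j \<le> u and m + i - j \<le> l are
   rearranged so that no truncated subtraction occurs. *)
definition cyclic_banded :: "nat \<Rightarrow> nat \<Rightarrow> nat \<Rightarrow> 'a::zero mat \<Rightarrow> bool" where
  "cyclic_banded m l u A \<longleftrightarrow> A \<in> carrier_mat m m \<and>
     (\<forall>i < m. \<forall>j < m. (i > j + l \<or> j > i + u) \<longrightarrow> \<not> (m + j \<le> i + u \<or> m + i \<le> j + l)
        \<longrightarrow> A $$ (i,j) = 0)"

definition block :: "nat \<Rightarrow> 'a mat \<Rightarrow> nat \<Rightarrow> nat \<Rightarrow> 'a mat" where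
  "block m A I J = mat m m (\<lambda>(i,j). A $$ (I * m + i, J * m + j))"

definition block_banded :: "nat \<Rightarrow> nat \<Rightarrow> nat \<Rightarrow> nat \<Rightarrow> 'a::zero mat \<Rightarrow> bool" where
  "block_banded m N l u A \<longleftrightarrow>
     (\<forall>I < N. \<forall>J < N. \<not> (- int l \<le> int J - int I \<and> int J - int I \<le> int u)
        \<longrightarrow> block m A I J = 0\<^sub>m m m)"

definition CB3 ::
    "nat \<Rightarrow> nat \<Rightarrow> nat \<Rightarrow> nat \<Rightarrow> nat \<Rightarrow> nat \<Rightarrow> 'a::zero mat \<Rightarrow> bool" where
  "CB3 m p l u lam mu A \<longleftrightarrow>
     A \<in> carrier_mat (m + p * m) (m + p * m) \<and>
     block_banded m (p + 1) l u A \<and>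
     cyclic_banded m (lam + mu) (lam + mu) (block m A 0 0) \<and>
     (\<forall>J \<in> {1..p}. cyclic_banded m lam mu (block m A 0 J)) \<and>
     (\<forall>I \<in> {1..p}. cyclic_banded m mu lam (block m A I 0)) \<and>
     (\<forall>I \<in> {1..p}. \<forall>J \<in> {1..p}. diagonal_mat (block m A I J))"

end

theory Submission
  imports Defs
begin

text \<open>
  Comparing entries in \<open>A = L\<^sup>T * L\<close> from the last row upwards shows that the entries of \<open>L\<close> below the
  diagonal stay inside any pattern \<open>P\<close> which contains the lower pattern of \<open>A\<close> and is closed under
  fill-in: \<open>P k i\<close> and \<open>P k j\<close> with \<open>k > i > j\<close> imply \<open>P i j\<close>. Outside the leading block such a
  pattern needs no fill-in beyond that of a banded matrix, because eliminating an unknown of a later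
  block only couples cyclically adjacent unknowns of the leading block. Within the leading block, the
  cyclic tridiagonal structure fills in the subdiagonal and the first column.
\<close>

lemma reverse_cholesky_factor_pattern:
  assumes L: "reverse_cholesky_factor A L"
    and pat: "\<And>i j. j < i \<Longrightarrow> i < dim_row A \<Longrightarrow> \<not> P i j \<Longrightarrow> A $$ (i,j) = 0"
    and fill: "\<And>k i j. j < i \<Longrightarrow> i < k \<Longrightarrow> k < dim_row A \<Longrightarrow> P k i \<Longrightarrow> P k j \<Longrightarrow> P i j"
    and "j < i" and "i < dim_row A" and "\<not> P i j"
  shows "L $$ (i,j) = 0"
  using assms(4-6)
\<comment> \<open>The measure is the distance of row \<open>i\<close> from the end, so the required
  zeros in all rows \<open>k > i\<close> are available when row \<open>i\<close> is treated.\<close>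
proof (induction "dim_row A - i" arbitrary: i j rule: less_induct)
  case less
  define n where "n = dim_row A"
  have car: "L \<in> carrier_mat n n" and A: "A = L\<^sup>T * L"
    using L unfolding reverse_cholesky_factor_def n_def by blast+
  have pos: "L $$ (i,i) > 0"
    using L less.prems unfolding reverse_cholesky_factor_def by blast
  have low: "\<And>r s. r < n \<Longrightarrow> s < n \<Longrightarrow> r < s \<Longrightarrow> L $$ (r,s) = 0"
    using L carrier_matD[OF car] unfolding reverse_cholesky_factor_def lower_triangular_def by metis
  have i: "i < n" and j: "j < n" using less.prems by (auto simp: n_def)
  have "0 = A $$ (i,j)" using pat less.prems by simp
  also have "\<dots> = (\<Sum>k\<in>{0..<n}. L $$ (k,i) * L $$ (k,j))"
    using car i j unfolding A by (simp add: scalar_prod_def)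
  \<comment> \<open>Terms with \<open>k < i\<close> vanish by triangularity. For
    \<open>k > i\<close>, the contrapositive of \<open>fill\<close> puts \<open>(k,i)\<close> or
    \<open>(k,j)\<close> outside \<open>P\<close>, so the induction hypothesis makes one factor
    zero. The surviving term has the positive factor \<open>L $$ (i,i)\<close>, which can be
    cancelled.\<close>
  also have "\<dots> = (\<Sum>k\<in>{0..<n}. if k = i then L $$ (i,i) * L $$ (i,j) else 0)"
  proof (rule sum.cong[OF refl])
    fix k assume k: "k \<in> {0..<n}"
    consider "k < i" | "k = i" | "i < k" by linarith
    then show "L $$ (k,i) * L $$ (k,j) = (if k = i then L $$ (i,i) * L $$ (i,j) else 0)"
    proof cases
      case 1
      then show ?thesis using low[of k i] i k by simp
    next
      case 3
      have "\<not> P k i \<or> \<not> P k j"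
        using fill[of j i k] less.prems 3 k by (auto simp: n_def)
      moreover have "dim_row A - k < dim_row A - i"
        using 3 k by (simp add: n_def diff_less_mono2)
      ultimately have "L $$ (k,i) = 0 \<or> L $$ (k,j) = 0"
        using less.hyps[of k i] less.hyps[of k j] 3 k less.prems by (auto simp: n_def)
      then show ?thesis using 3 by auto
    qed auto
  qed
  also have "\<dots> = L $$ (i,i) * L $$ (i,j)" using i by simp
  finally show ?case using pos by auto
qed

text \<open>The complement of the positions where \<open>cyclic_banded\<close> forces a zero; the
  last two disjuncts are the wrap-around corners.\<close>

definition cyclic_band :: "nat \<Rightarrow> nat \<Rightarrow> nat \<Rightarrow> nat \<Rightarrow> nat \<Rightarrow> bool" where
  "cyclic_band m l u i j \<longleftrightarrow> i \<le> j + l \<and> j \<le> i + u \<or> m + j \<le> i + u \<or> m + i \<le> j + l"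

text \<open>Meant for positions with \<open>b < a\<close> only. The leading block admits its whole
  first column, since a corner entry in row \<open>m - 1\<close> spreads upwards:
  \<open>(a,0)\<close> and \<open>(a,a-1)\<close> fill in \<open>(a-1,0)\<close>. Outside the
  leading block the shape is the one that \<open>A\<close> has.\<close>

definition factor_pattern :: "nat \<Rightarrow> nat \<Rightarrow> nat \<Rightarrow> nat \<Rightarrow> nat \<Rightarrow> nat \<Rightarrow> bool" where
  "factor_pattern m l lam mu a b \<longleftrightarrow>
     (if a < m then b = 0 \<or> a = b + 1
      else a div m \<le> b div m + l \<and>
        (if b < m then cyclic_band m mu lam (a mod m) b else a mod m = b mod m))"

lemma cyclic_banded_zero:
  assumes "cyclic_banded m l u B" "i < m" "j < m" "\<not> cyclic_band m l u i j"
  shows "B $$ (i,j) = 0"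
proof -
  have "i > j + l \<or> j > i + u" and "\<not> (m + j \<le> i + u \<or> m + i \<le> j + l)"
    using assms(4) by (simp_all only: cyclic_band_def de_Morgan_conj de_Morgan_disj not_le)
  then show ?thesis using assms(1-3) unfolding cyclic_banded_def by blast
qed

text \<open>A one-sided band of width one meets each row in at most two cyclically adjacent columns,
  so a pair that is not consecutive must wrap around through column 0. A two-sided band would also
  couple columns at distance two.\<close>

lemma cyclic_band_one_sided_adjacent:
  assumes lm: "lam = 1 \<and> mu = 0 \<or> lam = 0 \<and> mu = 1" and "k < m" "j < i" "i < m"
    and "cyclic_band m mu lam k i" "cyclic_band m mu lam k j"
  shows "j = 0 \<or> i = j + 1"
  using lm
proof (elim disjE conjE)
  assume "lam = 1" "mu = 0"
  then have "i = k \<or> i = k + 1 \<or> i = 0" and "j = k \<or> j = k + 1 \<or> j = 0"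
    using assms(2-6) by (auto simp: cyclic_band_def)
  then show ?thesis using \<open>j < i\<close> by auto
next
  assume "lam = 0" "mu = 1"
  then have "i = k \<or> k = i + 1 \<or> k = 0" and "j = k \<or> k = j + 1 \<or> k = 0 \<and> j = m - 1"
    using assms(2-6) by (auto simp: cyclic_band_def)
  then show ?thesis using \<open>j < i\<close> \<open>i < m\<close> by auto
qed

lemma factor_pattern_fill:
  assumes lm: "lam = 1 \<and> mu = 0 \<or> lam = 0 \<and> mu = 1"
    and "c < b" "b < a"
    and ab: "factor_pattern m l lam mu a b" and ac: "factor_pattern m l lam mu a c"
  shows "factor_pattern m l lam mu b c"
proof (cases "a < m")
  case True
  then show ?thesis using assms unfolding factor_pattern_def by auto
next
  case False
  show ?thesis
  proof (cases "m = 0")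
    case True
    \<comment> \<open>Here \<open>a mod 0 = a\<close>, so the pattern would force
      \<open>a = b\<close>.\<close>
    then show ?thesis using assms unfolding factor_pattern_def by auto
  next
    case m: False
    show ?thesis
    proof (cases "b < m")
      case True
      then have "c = 0 \<or> b = c + 1"
        using False assms m
        by (intro cyclic_band_one_sided_adjacent[OF lm, of "a mod m" m])
           (auto simp: factor_pattern_def)
      then show ?thesis using True by (simp add: factor_pattern_def)
    next
      case bm: False
      \<comment> \<open>Since \<open>a mod m = b mod m\<close>, rows \<open>a\<close> and
        \<open>b\<close> have the same position inside their blocks. The condition on column
        \<open>c\<close> therefore carries over from \<open>a\<close> to \<open>b\<close>, and the
        block bandwidth only becomes easier to meet.\<close>
      have "b div m \<le> a div m" using assms by (simp add: div_le_mono)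
      then show ?thesis using ab ac False bm by (auto simp: factor_pattern_def)
    qed
  qed
qed

lemma block_index_bound:
  assumes "I < N" "(i::nat) < m"
  shows "I * m + i < N * m"
proof -
  have "I * m + i < (I + 1) * m" using assms by simp
  also have "\<dots> \<le> N * m" using assms by (intro mult_le_mono1) simp
  finally show ?thesis .
qed

lemma CB3_zero_outside_factor_pattern:
  assumes A: "CB3 m p l l lam mu A" and lm: "lam = 1 \<and> mu = 0 \<or> lam = 0 \<and> mu = 1"
    and "b < a" and "a < dim_row A" and nP: "\<not> factor_pattern m l lam mu a b"
  shows "A $$ (a,b) = 0"
proof -
  have a: "a < (p + 1) * m" using assms by (auto simp: CB3_def)
  then have m: "m > 0" by (cases m) auto
  define I i J j where ij: "I = a div m" "i = a mod m" "J = b div m" "j = b mod m"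
  have im: "i < m" "j < m" using m by (auto simp: ij)
  have IJ: "I < p + 1" "J \<le> I" "J < p + 1"
    using a \<open>b < a\<close> less_mult_imp_div_less[of _ "p + 1" m] by (auto simp: ij div_le_mono)
  have entry: "block m A I J $$ (i,j) = A $$ (a,b)" using im by (simp add: block_def ij)
  have "block m A I J $$ (i,j) = 0"
  proof (cases "I \<le> J + l")
    case False
    then have "block m A I J = 0\<^sub>m m m"
      using A IJ unfolding CB3_def block_banded_def by auto
    then show ?thesis using im by simp
  next
    case IJl: True
    consider "I = 0" "J = 0" | "I > 0" "J = 0" | "I > 0" "J > 0" using IJ by linarith
    then show ?thesis
    proof cases
      case 1
      then have am: "a < m" "b < m" using m by (auto simp: ij div_eq_0_iff)
      \<comment> \<open>Below the diagonal, a cyclic tridiagonal block has only the subdiagonal and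
        the corner \<open>(m-1,0)\<close>, and both lie in the pattern. The bandwidth is 1 because
        \<open>lam + mu = 1\<close> in either case.\<close>
      have "\<not> cyclic_band m 1 1 i j"
        using nP am \<open>b < a\<close> by (auto simp: factor_pattern_def cyclic_band_def ij)
      moreover have "cyclic_banded m 1 1 (block m A 0 0)"
        using A lm by (auto simp: CB3_def)
      ultimately show ?thesis using 1 im cyclic_banded_zero by metis
    next
      case 2
      then have am: "\<not> a < m" "b < m" using m by (auto simp: ij div_eq_0_iff)
      then have "\<not> cyclic_band m mu lam i j"
        using nP IJl by (auto simp: factor_pattern_def ij)
      moreover have "cyclic_banded m mu lam (block m A I J)"
        using A 2 IJ by (auto simp: CB3_def)
      ultimately show ?thesis using im cyclic_banded_zero by metis
    next
      case 3
      then have am: "\<not> a < m" "\<not> b < m" using m by (auto simp: ij)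
      then have "i \<noteq> j"
        using nP IJl by (auto simp: factor_pattern_def ij)
      moreover have "diagonal_mat (block m A I J)"
        using A 3 IJ by (auto simp: CB3_def)
      ultimately show ?thesis using im by (auto simp: diagonal_mat_def block_def)
    qed
  qed
  then show ?thesis using entry by simp
qed

text \<open>Once the first column of the leading block is cleared by \<open>col\<close>, the fill-in
  that could break cyclic bandedness is gone. What remains there is at most diagonal and
  subdiagonal, well within bandwidth two, and triangularity disposes of everything above the
  diagonal.\<close>

lemma CB3_factor_pattern:
  fixes M :: "'a::zero mat"
  assumes lm: "lam = 1 \<and> mu = 0 \<or> lam = 0 \<and> mu = 1"
    and car: "M \<in> carrier_mat (m + p * m) (m + p * m)"
    and low: "lower_triangular M"
    and pat: "\<And>a b. b < a \<Longrightarrow> a < m + p * m \<Longrightarrow> \<not> factor_pattern m l lam mu a b \<Longrightarrow> M $$ (a,b) = 0"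
    and col: "\<And>a. a < m \<Longrightarrow> M $$ (a,0) = 0"
  shows "CB3 m p l 0 1 1 M"
proof -
  have bnd: "I * m + i < m + p * m" if "I < p + 1" "i < m" for I i
    using block_index_bound[OF that] by simp
  have low': "M $$ (a,b) = 0" if "a < b" "b < m + p * m" for a b
    using low car that by (auto simp: lower_triangular_def)
  have upper: "M $$ (I * m + i, J * m + j) = 0"
    if "I < J" "J < p + 1" "i < m" "j < m" for I J i j
  proof (rule low')
    show "I * m + i < J * m + j" using block_index_bound[OF that(1,3)] by simp
  qed (use bnd that in auto)
  have below: "M $$ (I * m + i, J * m + j) = 0"
    if "J < I" "I < p + 1" "i < m" "j < m" "\<not> factor_pattern m l lam mu (I * m + i) (J * m + j)"
    for I J i j
  proof (rule pat)
    show "J * m + j < I * m + i" using block_index_bound[OF that(1,4)] by simp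
  qed (use bnd that in auto)
  have nlt: "\<not> I * m + i < m" if "0 < I" for I i
    using that by (cases I) auto
  have banded: "block_banded m (p + 1) l 0 M"
    unfolding block_banded_def
  proof (intro allI impI)
    fix I J
    assume I: "I < p + 1" and J: "J < p + 1"
      and "\<not> (- int l \<le> int J - int I \<and> int J - int I \<le> int 0)"
    then have IJ: "I < J \<or> I > J + l" by linarith
    have "M $$ (I * m + i, J * m + j) = 0" if "i < m" "j < m" for i j
    proof (cases "I < J")
      case True
      then show ?thesis using upper J that by blast
    next
      case False
      then show ?thesis using IJ I that nlt[of I i]
        by (intro below) (auto simp: factor_pattern_def)
    qed
    then show "block m M I J = 0\<^sub>m m m" by (intro eq_matI) (auto simp: block_def)
  qed
  have lead: "cyclic_banded m (1 + 1) (1 + 1) (block m M 0 0)"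
  proof -
    have "M $$ (i,j) = 0" if "i < m" "j < m" "i > j + 2 \<or> j > i + 2" for i j
    proof (cases "i < j")
      case True
      then show ?thesis using that low' by simp
    next
      case False
      then show ?thesis using that col pat[of j i]
        by (cases "j = 0") (auto simp: factor_pattern_def)
    qed
    then show ?thesis by (auto simp: cyclic_banded_def block_def)
  qed
  have row: "cyclic_banded m 1 1 (block m M 0 J)" if "J \<in> {1..p}" for J
    using upper[of 0 J] that by (auto simp: cyclic_banded_def block_def)
  have column: "cyclic_banded m 1 1 (block m M I 0)" if I: "I \<in> {1..p}" for I
  proof -
    have "M $$ (I * m + i, j) = 0"
      if "i < m" "j < m" "i > j + 1 \<or> j > i + 1" "\<not> (m + j \<le> i + 1 \<or> m + i \<le> j + 1)" for i j
    proof -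
      \<comment> \<open>The one-sided band of either type is contained in the band with both widths
        1.\<close>
      have "\<not> cyclic_band m mu lam i j" using that lm by (auto simp: cyclic_band_def)
      then show ?thesis using that I below[of 0 I i j] nlt[of I i]
        by (auto simp: factor_pattern_def)
    qed
    then show ?thesis by (auto simp: cyclic_banded_def block_def)
  qed
  have diag: "diagonal_mat (block m M I J)" if I: "I \<in> {1..p}" and J: "J \<in> {1..p}" for I J
  proof -
    have "M $$ (I * m + i, J * m + j) = 0" if ij: "i < m" "j < m" "i \<noteq> j" for i j
    proof -
      have nP: "\<not> factor_pattern m l lam mu (I * m + i) (J * m + j)"
        using ij I J nlt[of I i] nlt[of J j] by (auto simp: factor_pattern_def)
      consider "I < J" | "I > J" | "I = J" "i < j" | "I = J" "j < i" using ij by linarith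
      then show ?thesis
      proof cases
        case 1
        then show ?thesis using upper J ij by auto
      next
        case 2
        then show ?thesis using below nP I ij by auto
      next
        case 3
        then show ?thesis using low' bnd[of J j] J ij by auto
      next
        case 4
        then show ?thesis using pat nP bnd[of I i] I ij by auto
      qed
    qed
    then show ?thesis by (auto simp: diagonal_mat_def block_def)
  qed
  show ?thesis
    unfolding CB3_def using car banded lead row column diag by blast
qed

theorem theorem2:
  fixes m p l :: nat and A L :: "real mat"
  assumes "symmetric_mat A" and "pos_def_mat A"
    and "CB3 m p l l 1 0 A \<or> CB3 m p l l 0 1 A"
    and "reverse_cholesky_factor A L"
  shows "\<exists>L1 L2 L2t. L = L1 + L2 \<and> CB3 m p l 0 1 1 L1 \<and>
           L2t \<in> carrier_mat m m \<and>
           (\<forall>i < m. \<forall>j < m. j \<noteq> 0 \<longrightarrow> L2t $$ (i,j) = 0) \<and>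
           L2 = four_block_mat L2t (0\<^sub>m m (p * m)) (0\<^sub>m (p * m) m) (0\<^sub>m (p * m) (p * m))"
proof -
  obtain lam mu :: nat where lm: "lam = 1 \<and> mu = 0 \<or> lam = 0 \<and> mu = 1"
    and A: "CB3 m p l l lam mu A"
    using assms(3) by auto
  let ?n = "m + p * m"
  have dimA: "dim_row A = ?n" using A by (auto simp: CB3_def)
  have car: "L \<in> carrier_mat ?n ?n" and low: "lower_triangular L"
    using assms(4) dimA by (auto simp: reverse_cholesky_factor_def)
  have pat: "L $$ (a,b) = 0"
    if "b < a" "a < ?n" "\<not> factor_pattern m l lam mu a b" for a b
    using assms(4)
  proof (rule reverse_cholesky_factor_pattern[where P = "factor_pattern m l lam mu"])
    show "A $$ (i,j) = 0" if "j < i" "i < dim_row A" "\<not> factor_pattern m l lam mu i j" for i j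
      using CB3_zero_outside_factor_pattern[OF A lm] that .
    show "factor_pattern m l lam mu i j"
      if "j < i" "i < k" "factor_pattern m l lam mu k i" "factor_pattern m l lam mu k j" for k i j
      using factor_pattern_fill[OF lm] that .
  qed (use that dimA in auto)
  \<comment> \<open>The whole first column of the leading block moves to \<open>L2t\<close>,
    including the positive diagonal entry at \<open>(0,0)\<close>. This is harmless, as
    \<open>CB3\<close> only demands zeros.\<close>
  define L1 where "L1 = mat ?n ?n (\<lambda>(a,b). if a < m \<and> b = 0 then 0 else L $$ (a,b))"
  define L2t where "L2t = mat m m (\<lambda>(a,b). if b = 0 then L $$ (a,b) else 0)"
  define L2 where
    "L2 = four_block_mat L2t (0\<^sub>m m (p * m)) (0\<^sub>m (p * m) m) (0\<^sub>m (p * m) (p * m))"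
  have "L = L1 + L2"
    using car by (intro eq_matI) (auto simp: L1_def L2_def L2t_def)
  moreover have "CB3 m p l 0 1 1 L1"
  proof (rule CB3_factor_pattern[OF lm])
    show "lower_triangular L1"
      using low car by (auto simp: lower_triangular_def L1_def)
    show "L1 $$ (a,b) = 0" if "b < a" "a < ?n" "\<not> factor_pattern m l lam mu a b" for a b
      using pat[OF that] that by (simp add: L1_def)
  qed (auto simp: L1_def)
  moreover have "L2t \<in> carrier_mat m m"
    and "\<forall>i < m. \<forall>j < m. j \<noteq> 0 \<longrightarrow> L2t $$ (i,j) = 0"
    by (auto simp: L2t_def)
  ultimately show ?thesis using L2_def by blast
qed

end
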